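(* Let $L,n\in\mathbb{N}$, $H=\lfloor L/2\rfloor$, let $z$ be any point of $\mathcal{T}_L$ and let $(p_0(z),\dots,p_H(z))$ be the profile of $z$. Let $f_n(z)$ be the number of forward paths in $\mathcal{T}_L$ of length $n$ starting from $z$, and let $m_n(i)$ be the number of Motzkin meanders of length $n$ starting at height $i$ and having amplitude bounded by $L$. Then $$f_n(z)=\sum_{i=0}^{H}p_i(z)\,m_n(i).$$
   Context: $\mathbb{N}=\{0,1,2,\dots\}$ and $(e_1,e_2,e_3)$ is the standard basis of $\mathbb{R}^3$. $\mathcal{T}_L=\{x_1e_1+x_2e_2+x_3e_3 : x_1,x_2,x_3\in\mathbb{N},\ x_1+x_2+x_3=L\}$. Forward steps: $s_1=e_1-e_3$, $s_2=e_2-e_1$, $s_3=e_3-e_2$. A forward path of length $n$ starting from $z\in\mathcal{T}_L$ is a sequence $(\sigma_1,\dots,\sigma_n)\in\{s_1,s_2,s_3\}^n$ with $z+\sum_{i=1}^k\sigma_i\in\mathcal{T}_L$ for all $k\in\{0,\dots,n\}$. Profile: for $z=ae_1+be_2+ce_3\in\mathcal{T}_L$, $(p_0(z),\dots,p_H(z))$ are the coefficients of $x^0,\dots,x^H$ in the polynomial $\dfrac{(1-x^{a+1})(1-x^{b+1})(1-x^{c+1})}{(1-x)^2}$. A Motzkin meander is a sequence of steps $\nearrow$ (height $+1$), $\rightarrow$ (height $+0$), $\searrow$ (height $-1$) that starts at some height $\ge 0$, stays at height $\ge 0$ and ends at height $0$. The amplitude of a meander with maximum height $h$ (starting height included) is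 $2h+1$ if a horizontal step is performed at height $h$, and $2h$ otherwise; "bounded by $L$" means $\le L$. *)

theory Defs
  imports "HOL-Analysis.Analysis" "HOL-Computational_Algebra.Polynomial"
begin

definition basis_vec :: "3 \<Rightarrow> real^3" where
  "basis_vec j = axis j 1"

definition lattice_triangle :: "nat \<Rightarrow> (real^3) set" where
  "lattice_triangle L = {real x1 *\<^sub>R basis_vec 1 + real x2 *\<^sub>R basis_vec 2 + real x3 *\<^sub>R basis_vec 3 | x1 x2 x3.
     x1 + x2 + x3 = L}"

definition forward_steps :: "(real^3) set" where
  "forward_steps =
     {basis_vec 1 - basis_vec 3, basis_vec 2 - basis_vec 1, basis_vec 3 - basis_vec 2}"

definition forward_paths :: "nat \<Rightarrow> nat \<Rightarrow> real^3 \<Rightarrow> (real^3) list set" where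
  "forward_paths L n z = {\<sigma>. length \<sigma> = n \<and> set \<sigma> \<subseteq> forward_steps \<and>
     (\<forall>k\<le>n. z + (\<Sum>i<k. \<sigma> ! i) \<in> lattice_triangle L)}"

definition num_forward_paths :: "nat \<Rightarrow> nat \<Rightarrow> real^3 \<Rightarrow> nat" where
  "num_forward_paths L n z = card (forward_paths L n z)"

(* The division below is exact. *)
definition profile_poly :: "nat \<Rightarrow> nat \<Rightarrow> nat \<Rightarrow> int poly" where
  "profile_poly a b c =
     ((1 - monom 1 (a + 1)) * (1 - monom 1 (b + 1)) * (1 - monom 1 (c + 1))) div (1 - monom 1 1)\<^sup>2"

(* Meaningful when z lies in some triangle: there the coordinates are natural numbers,
   and the floors merely convert them from real to nat. *)
definition profile :: "real^3 \<Rightarrow> nat \<Rightarrow> int" where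
  "profile z k = coeff (profile_poly (nat \<lfloor>z $ 1\<rfloor>) (nat \<lfloor>z $ 2\<rfloor>) (nat \<lfloor>z $ 3\<rfloor>)) k"

datatype motzkin_step = Up | Horizontal | Down

fun step_height :: "motzkin_step \<Rightarrow> int" where
  "step_height Up = 1"
| "step_height Horizontal = 0"
| "step_height Down = -1"

(* Height reached after the first k steps of w, starting from height i. *)
definition height_after :: "nat \<Rightarrow> motzkin_step list \<Rightarrow> nat \<Rightarrow> int" where
  "height_after i w k = int i + (\<Sum>j<k. step_height (w ! j))"

definition motzkin_meander :: "nat \<Rightarrow> motzkin_step list \<Rightarrow> bool" where
  "motzkin_meander i w \<longleftrightarrow>
     (\<forall>k\<le>length w. 0 \<le> height_after i w k) \<and> height_after i w (length w) = 0"

definition max_height :: "nat \<Rightarrow> motzkin_step list \<Rightarrow> int" where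
  "max_height i w = Max (height_after i w ` {..length w})"

definition amplitude :: "nat \<Rightarrow> motzkin_step list \<Rightarrow> int" where
  "amplitude i w =
     (if \<exists>k<length w. w ! k = Horizontal \<and> height_after i w k = max_height i w
      then 2 * max_height i w + 1 else 2 * max_height i w)"

definition num_meanders :: "nat \<Rightarrow> nat \<Rightarrow> nat \<Rightarrow> nat" where
  "num_meanders L n i =
     card {w. length w = n \<and> motzkin_meander i w \<and> amplitude i w \<le> int L}"

end

(* By induction on n it suffices that the profile intertwines the two one-step recursions.
   Write A = x^(a+1), B = x^(b+1), C = x^(c+1).  Summing the products
   (1 - A)(1 - B)(1 - C) over the three forward neighbours of z gives
   (x + 1 + 1/x)(1 - A)(1 - B)(1 - C) - (1 - x)^2 (1 - ABC) / x, so in the range 0..L+1 the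
   neighbours' profiles add up to p_(k-1) + p_k + p_(k+1).  A neighbour outside the triangle has
   a factor 1 - x^0 = 0, hence contributes nothing on either side.  At height H the antisymmetry
   p_(L+1-k) = -p_k reproduces the amplitude bound: p_(H+1) is -p_H for even L, which forbids the
   horizontal step at height H, and 0 for odd L. *)

theory Submission
  imports Defs
begin

section \<open>Profiles\<close>

definition profile_num :: "nat \<Rightarrow> nat \<Rightarrow> nat \<Rightarrow> int poly" where
  "profile_num A B C = (1 - monom 1 A) * (1 - monom 1 B) * (1 - monom 1 C)"

(* Shifting the coordinates by one lets natural exponents cover the points just outside the
   triangle, which have a coordinate -1. *)
definition shifted_profile :: "nat \<Rightarrow> nat \<Rightarrow> nat \<Rightarrow> int poly" where
  "shifted_profile A B C = profile_num A B C div (1 - monom 1 1)\<^sup>2"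

lemma profile_poly_eq_shifted: "profile_poly a b c = shifted_profile (a + 1) (b + 1) (c + 1)"
  by (simp add: profile_poly_def shifted_profile_def profile_num_def)

lemma one_minus_monom_neq_0: "0 < A \<Longrightarrow> 1 - monom (1::int) A \<noteq> 0"
proof
  assume "0 < A" "1 - monom (1::int) A = 0"
  then have "coeff (1 - monom (1::int) A) 0 = 0" by simp
  with \<open>0 < A\<close> show False by simp
qed

lemma one_minus_X_dvd: "(1 - monom (1::int) 1) dvd (1 - monom 1 A)"
proof -
  have "1 - monom (1::int) A = 1 - monom 1 1 ^ A"
    by (simp add: monom_power)
  also have "\<dots> = (1 - monom 1 1) * (\<Sum>i<A. monom 1 1 ^ i)"
    by (rule one_diff_power_eq)
  finally show ?thesis by simp
qed

text \<open>Two of the three factors already supply the divisor, so the division is exact. Later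
  identities between profiles are proved for the numerators and then divided by cancelling the
  nonzero square.\<close>

lemma shifted_profile_mult: "(1 - monom 1 1)\<^sup>2 * shifted_profile A B C = profile_num A B C"
proof -
  have "(1 - monom (1::int) 1)\<^sup>2 dvd (1 - monom 1 A) * (1 - monom 1 B)"
    unfolding power2_eq_square by (intro mult_dvd_mono one_minus_X_dvd)
  then have "(1 - monom (1::int) 1)\<^sup>2 dvd profile_num A B C"
    unfolding profile_num_def by (rule dvd_mult2)
  then show ?thesis
    by (simp add: shifted_profile_def)
qed

lemma shifted_profile_eq_0: "A = 0 \<or> B = 0 \<or> C = 0 \<Longrightarrow> shifted_profile A B C = 0"
  by (auto simp: shifted_profile_def profile_num_def)

lemma coeff_shifted_profile_0:
  assumes "0 < A" "0 < B" "0 < C"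
  shows "coeff (shifted_profile A B C) 0 = 1"
proof -
  have "coeff ((1 - monom 1 1)\<^sup>2 * shifted_profile A B C) 0 = coeff (profile_num A B C) 0"
    by (simp only: shifted_profile_mult)
  then show ?thesis
    using assms by (simp add: profile_num_def coeff_mult_0 power2_eq_square)
qed

text \<open>The three neighbours scale the monomials (x^(a+1), x^(b+1), x^(c+1)) by (x, 1, 1/x),
  (1/x, x, 1) and (1, 1/x, x). A product of one or two of them thus picks up x, 1 and 1/x once each,
  whereas the constant term and the full product keep weight 1 three times. The discrepancy 3 - (x +
  1 + 1/x) = -(1 - x)^2 / x gives the two correction terms. The extra factor x keeps all exponents
  natural.\<close>

lemma shifted_profile_neighbours:
  fixes a b c :: nat
  shows "monom 1 1 * (shifted_profile (a + 2) (b + 1) c + shifted_profile a (b + 2) (c + 1)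
           + shifted_profile (a + 1) b (c + 2))
    = (1 + monom 1 1 + monom 1 2) * shifted_profile (a + 1) (b + 1) (c + 1)
      - 1 + monom 1 (a + b + c + 3)" (is "?l = ?r")
proof -
  define X :: "int poly" where "X = monom 1 1"
  have m: "monom (1::int) k = X ^ k" for k
    by (simp add: X_def monom_power)
  have "(1 - monom 1 1)\<^sup>2 * ?l = monom 1 1 * (profile_num (a + 2) (b + 1) c
      + profile_num a (b + 2) (c + 1) + profile_num (a + 1) b (c + 2))"
    unfolding shifted_profile_mult[symmetric] by (simp only: algebra_simps)
  also have "\<dots> = (1 + monom 1 1 + monom 1 2) * profile_num (a + 1) (b + 1) (c + 1)
      - (1 - monom 1 1)\<^sup>2 * (1 - monom 1 (a + b + c + 3))"
    \<comment> \<open>Once the exponents are split, this is a polynomial identity in X, X^a, X^b and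
      X^c.\<close>
    unfolding profile_num_def m power_add by algebra
  also have "\<dots> = (1 - monom 1 1)\<^sup>2 * ?r"
    unfolding shifted_profile_mult[symmetric] by (simp only: algebra_simps)
  finally have "(1 - monom 1 1)\<^sup>2 * ?l = (1 - monom 1 1)\<^sup>2 * ?r" .
  moreover have "(1 - monom (1::int) 1)\<^sup>2 \<noteq> 0"
    using one_minus_monom_neq_0[of 1] by simp
  ultimately show ?thesis
    using mult_left_cancel by blast
qed

text \<open>Compare coefficients of x^(k+1): the correction -1 sits at degree 0, and the bound on k
  keeps k + 1 below the other correction, at degree a + b + c + 3.\<close>

lemma coeff_shifted_profile_neighbours:
  assumes "k \<le> a + b + c + 1"
  shows "coeff (shifted_profile (a + 2) (b + 1) c) k + coeff (shifted_profile a (b + 2) (c + 1)) k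
           + coeff (shifted_profile (a + 1) b (c + 2)) k
    = (if k = 0 then 0 else coeff (shifted_profile (a + 1) (b + 1) (c + 1)) (k - 1))
      + coeff (shifted_profile (a + 1) (b + 1) (c + 1)) k
      + coeff (shifted_profile (a + 1) (b + 1) (c + 1)) (k + 1)"
proof -
  have "coeff (monom 1 1 * (shifted_profile (a + 2) (b + 1) c + shifted_profile a (b + 2) (c + 1)
           + shifted_profile (a + 1) b (c + 2))) (k + 1)
    = coeff ((1 + monom 1 1 + monom 1 2) * shifted_profile (a + 1) (b + 1) (c + 1)
      - 1 + monom 1 (a + b + c + 3)) (k + 1)"
    by (simp only: shifted_profile_neighbours)
  then show ?thesis
    using assms by (cases k) (auto simp: distrib_right coeff_monom_mult)
qed

section \<open>Antisymmetry of the profile under reversal of degrees\<close>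

lemma degree_one_minus_monom: "0 < A \<Longrightarrow> degree (1 - monom (1::int) A) = A"
  by (intro antisym degree_le le_degree) auto

lemma reflect_one_minus_monom:
  assumes "0 < A"
  shows "reflect_poly (1 - monom (1::int) A) = - (1 - monom 1 A)"
  using assms by (intro poly_eqI) (auto simp: coeff_reflect_poly degree_one_minus_monom)

text \<open>Reversing the coefficients negates every factor 1 - x^A. Three factors in the numerator
  and two in the denominator leave one sign in total.\<close>

lemma coeff_shifted_profile_antisym:
  assumes "0 < A" "0 < B" "0 < C" and "k + l + 2 = A + B + C"
  shows "coeff (shifted_profile A B C) k = - coeff (shifted_profile A B C) l"
proof -
  let ?P = "shifted_profile A B C"
  let ?D = "(1 - monom (1::int) 1)\<^sup>2"
  note nz = one_minus_monom_neq_0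
  have D0: "?D \<noteq> 0" using nz[of 1] by simp
  have degD: "degree ?D = 2"
    by (simp only: power2_eq_square degree_mult_eq nz degree_one_minus_monom
        zero_less_one simp_thms one_add_one)
  have "profile_num A B C \<noteq> 0"
    using assms nz by (simp add: profile_num_def)
  then have P0: "?P \<noteq> 0"
    using shifted_profile_mult[of A B C] by auto
  \<comment> \<open>\<open>reflect_poly\<close> reverses about the actual degree, which must
    therefore be known to be k + l.\<close>
  have "2 + degree ?P = degree (profile_num A B C)"
    using degree_mult_eq[OF D0 P0] unfolding shifted_profile_mult degD by simp
  also have "\<dots> = A + B + C"
    using assms nz by (simp add: profile_num_def degree_mult_eq degree_one_minus_monom)
  finally have deg: "degree ?P = k + l"
    using assms by simp
  have "?D * reflect_poly ?P = reflect_poly (?D * ?P)"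
    by (simp only: reflect_poly_mult power2_eq_square reflect_one_minus_monom zero_less_one
        minus_mult_minus)
  also have "\<dots> = - profile_num A B C"
    unfolding shifted_profile_mult using assms
    by (simp only: profile_num_def reflect_poly_mult reflect_one_minus_monom
        minus_mult_left[symmetric] minus_mult_right[symmetric] minus_minus)
  also have "\<dots> = ?D * (- ?P)"
    unfolding shifted_profile_mult[symmetric] by simp
  finally have "reflect_poly ?P = - ?P"
    using D0 mult_left_cancel by blast
  then have "coeff (reflect_poly ?P) k = - coeff ?P k" by simp
  then show ?thesis
    by (simp add: coeff_reflect_poly deg)
qed

section \<open>Forward paths\<close>

lemma finite_forward_paths: "finite (forward_paths L n z)"
proof (rule finite_subset)
  show "forward_paths L n z \<subseteq> {\<sigma>. set \<sigma> \<subseteq> forward_steps \<and> length \<sigma> = n}"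
    by (auto simp: forward_paths_def)
  show "finite {\<sigma>. set \<sigma> \<subseteq> forward_steps \<and> length \<sigma> = n}"
    by (rule finite_lists_length_eq) (simp add: forward_steps_def)
qed

lemma forward_paths_outside: "z \<notin> lattice_triangle L \<Longrightarrow> forward_paths L n z = {}"
  by (auto simp: forward_paths_def)

lemma num_forward_paths_0: "z \<in> lattice_triangle L \<Longrightarrow> num_forward_paths L 0 z = 1"
proof -
  assume "z \<in> lattice_triangle L"
  then have "forward_paths L 0 z = {[]}" by (auto simp: forward_paths_def)
  then show ?thesis by (simp add: num_forward_paths_def)
qed

lemma Cons_in_forward_paths:
  assumes "z \<in> lattice_triangle L"
  shows "s # \<tau> \<in> forward_paths L (Suc n) z \<longleftrightarrow>
    s \<in> forward_steps \<and> \<tau> \<in> forward_paths L n (z + s)"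
  using assms
  by (auto simp: forward_paths_def All_less_Suc2 simp flip: less_Suc_eq_le
      simp: sum.lessThan_Suc_shift add.assoc simp del: sum.lessThan_Suc)

lemma forward_paths_Suc:
  assumes "z \<in> lattice_triangle L"
  shows "forward_paths L (Suc n) z = (\<Union>s\<in>forward_steps. Cons s ` forward_paths L n (z + s))"
proof (rule set_eqI)
  fix \<sigma>
  show "\<sigma> \<in> forward_paths L (Suc n) z \<longleftrightarrow>
      \<sigma> \<in> (\<Union>s\<in>forward_steps. Cons s ` forward_paths L n (z + s))"
  proof (cases \<sigma>)
    case Nil
    then show ?thesis by (auto simp: forward_paths_def)
  next
    case (Cons s \<tau>)
    then show ?thesis using Cons_in_forward_paths[OF assms, of s \<tau> n] by auto
  qed
qed

text \<open>Neighbours outside the triangle are included in the sum; by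
  \<open>forward_paths_outside\<close> they contribute 0.\<close>

lemma num_forward_paths_Suc:
  assumes "z \<in> lattice_triangle L"
  shows "num_forward_paths L (Suc n) z = (\<Sum>s\<in>forward_steps. num_forward_paths L n (z + s))"
proof -
  have "card (\<Union>s\<in>forward_steps. Cons s ` forward_paths L n (z + s))
      = (\<Sum>s\<in>forward_steps. card (Cons s ` forward_paths L n (z + s)))"
    by (rule card_UN_disjoint) (auto simp: forward_steps_def finite_forward_paths)
  then show ?thesis
    by (simp add: num_forward_paths_def forward_paths_Suc[OF assms] card_image)
qed

text \<open>Same offset as in \<open>shifted_profile\<close>, so a point and its profile share one
  index triple. The subtraction is real: index 0 stands for coordinate -1.\<close>

definition shifted_point :: "nat \<Rightarrow> nat \<Rightarrow> nat \<Rightarrow> real^3" where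
  "shifted_point A B C = vector [real A - 1, real B - 1, real C - 1]"

lemma basis_vec_nth:
  "basis_vec 1 $ 1 = 1" "basis_vec 1 $ 2 = 0" "basis_vec 1 $ 3 = 0"
  "basis_vec 2 $ 1 = 0" "basis_vec 2 $ 2 = 1" "basis_vec 2 $ 3 = 0"
  "basis_vec 3 $ 1 = 0" "basis_vec 3 $ 2 = 0" "basis_vec 3 $ 3 = 1"
  by (simp_all add: basis_vec_def axis_def)

lemma sum_forward_steps:
  fixes f :: "real^3 \<Rightarrow> nat"
  shows "(\<Sum>s\<in>forward_steps. f s) = f (basis_vec 1 - basis_vec 3)
    + f (basis_vec 2 - basis_vec 1) + f (basis_vec 3 - basis_vec 2)"
proof -
  have "basis_vec 1 - basis_vec 3 \<noteq> basis_vec 2 - basis_vec 1"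
    "basis_vec 1 - basis_vec 3 \<noteq> basis_vec 3 - basis_vec 2"
    "basis_vec 2 - basis_vec 1 \<noteq> basis_vec 3 - basis_vec 2"
    by (simp_all add: vec_eq_iff forall_3 basis_vec_nth)
  then show ?thesis by (simp add: forward_steps_def)
qed

lemma shifted_point_add_step:
  "shifted_point (a + 1) (b + 1) (c + 1) + (basis_vec 1 - basis_vec 3) = shifted_point (a + 2) (b + 1) c"
  "shifted_point (a + 1) (b + 1) (c + 1) + (basis_vec 2 - basis_vec 1) = shifted_point a (b + 2) (c + 1)"
  "shifted_point (a + 1) (b + 1) (c + 1) + (basis_vec 3 - basis_vec 2) = shifted_point (a + 1) b (c + 2)"
  by (simp_all add: shifted_point_def vec_eq_iff forall_3 basis_vec_nth)

lemma lattice_triangle_iff: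
  "z \<in> lattice_triangle L \<longleftrightarrow> (\<exists>a b c. a + b + c = L \<and> z = shifted_point (a + 1) (b + 1) (c + 1))"
  unfolding lattice_triangle_def
  by (auto simp: shifted_point_def vec_eq_iff forall_3 basis_vec_nth)

lemma shifted_point_outside:
  assumes "A = 0 \<or> B = 0 \<or> C = 0"
  shows "shifted_point A B C \<notin> lattice_triangle L"
  using assms by (auto simp: lattice_triangle_iff shifted_point_def vec_eq_iff forall_3)

section \<open>Bounded meanders\<close>

text \<open>Replaces the maximum by conditions on single steps, which are inherited when the first
  step is removed.\<close>

lemma amplitude_le_iff:
  "amplitude i w \<le> int L \<longleftrightarrow> (\<forall>k\<le>length w. 2 * height_after i w k \<le> int L) \<and>
     (\<forall>k<length w. w ! k = Horizontal \<longrightarrow> 2 * height_after i w k + 1 \<le> int L)"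
  (is "?l \<longleftrightarrow> ?r")
proof -
  let ?h = "height_after i w" and ?M = "max_height i w"
  have le: "?h k \<le> ?M" if "k \<le> length w" for k
    using that by (simp add: max_height_def)
  have "?M \<in> ?h ` {..length w}"
    unfolding max_height_def by (rule Max_in) auto
  then obtain m where m: "m \<le> length w" "?h m = ?M" by auto
  show ?thesis
  proof
    assume l: ?l
    have "2 * ?h k + 1 \<le> int L" if "k < length w" "w ! k = Horizontal" for k
    proof (cases "?h k = ?M")
      case True
      then show ?thesis using that l by (auto simp: amplitude_def split: if_splits)
    next
      \<comment> \<open>Heights are integers, so a horizontal step below the maximum M has 2h + 1 <
        2M, and 2M is within the bound.\<close>
      case False
      then show ?thesis using that l le[of k] by (auto simp: amplitude_def split: if_splits)
    qed
    moreover have "2 * ?h k \<le> int L" if "k \<le> length w" for k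
      using le[OF that] l by (auto simp: amplitude_def split: if_splits)
    ultimately show ?r by blast
  next
    assume ?r
    then show ?l using m by (auto simp: amplitude_def)
  qed
qed

definition bounded_meanders :: "nat \<Rightarrow> nat \<Rightarrow> nat \<Rightarrow> motzkin_step list set" where
  "bounded_meanders L n i = {w. length w = n \<and> motzkin_meander i w \<and> amplitude i w \<le> int L}"

lemma bounded_meanders_iff:
  "w \<in> bounded_meanders L n i \<longleftrightarrow> length w = n \<and> height_after i w n = 0 \<and>
     (\<forall>k\<le>n. 0 \<le> height_after i w k \<and> 2 * height_after i w k \<le> int L) \<and>
     (\<forall>k<n. w ! k = Horizontal \<longrightarrow> 2 * height_after i w k + 1 \<le> int L)"
  by (auto simp: bounded_meanders_def motzkin_meander_def amplitude_le_iff)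

section \<open>Decomposition of a bounded meander by its first step\<close>

lemma height_after_0: "height_after i w 0 = int i"
  by (simp add: height_after_def)

lemma height_after_Cons_Suc:
  "int j = int i + step_height s \<Longrightarrow> height_after i (s # w) (Suc k) = height_after j w k"
  by (simp add: height_after_def sum.lessThan_Suc_shift del: sum.lessThan_Suc)

text \<open>The conditions on \<open>i\<close> are those at position 0. A natural \<open>j\<close>
  exists unless the step goes down from height 0, the case covered by
  \<open>Down_notin_bounded_meanders_0\<close>.\<close>

lemma Cons_in_bounded_meanders:
  assumes "int j = int i + step_height s"
  shows "s # w \<in> bounded_meanders L (Suc n) i \<longleftrightarrow> w \<in> bounded_meanders L n j \<and>
    2 * i \<le> L \<and> (s = Horizontal \<longrightarrow> 2 * i + 1 \<le> L)"
  unfolding bounded_meanders_iff less_Suc_eq_le[symmetric] All_less_Suc2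
  by (auto simp: height_after_Cons_Suc[OF assms] height_after_0 All_less_Suc2)

lemma Down_notin_bounded_meanders_0: "Down # w \<notin> bounded_meanders L n 0"
  by (auto simp: bounded_meanders_iff height_after_def dest!: spec[of _ 1])

lemma Nil_notin_bounded_meanders_Suc: "[] \<notin> bounded_meanders L (Suc n) i"
  by (simp add: bounded_meanders_iff)

text \<open>The upward branch carries no guard because its set is empty if i + 1 is too high. The
  guard on the downward branch avoids the truncated 0 - 1.\<close>

lemma bounded_meanders_Suc:
  assumes "2 * i \<le> L"
  shows "bounded_meanders L (Suc n) i = Cons Up ` bounded_meanders L n (i + 1)
    \<union> (if 2 * i + 1 \<le> L then Cons Horizontal ` bounded_meanders L n i else {})
    \<union> (if i = 0 then {} else Cons Down ` bounded_meanders L n (i - 1))" (is "_ = ?R")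
proof (rule set_eqI)
  fix v
  show "v \<in> bounded_meanders L (Suc n) i \<longleftrightarrow> v \<in> ?R"
  proof (cases v)
    case Nil
    then show ?thesis by (auto simp: Nil_notin_bounded_meanders_Suc)
  next
    case (Cons s w)
    show ?thesis
    proof (cases s)
      case Up
      with Cons assms show ?thesis
        using Cons_in_bounded_meanders[of "i + 1" i s w L n] by auto
    next
      case Horizontal
      with Cons assms show ?thesis
        using Cons_in_bounded_meanders[of i i s w L n] by auto
    next
      case Down
      with Cons assms show ?thesis
        using Cons_in_bounded_meanders[of "i - 1" i s w L n] Down_notin_bounded_meanders_0[of w L "Suc n"]
        by (cases "i = 0") auto
    qed
  qed
qed

lemma finite_bounded_meanders: "finite (bounded_meanders L n i)"
proof (rule finite_subset)
  show "bounded_meanders L n i \<subseteq> {w. set w \<subseteq> UNIV \<and> length w = n}"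
    by (auto simp: bounded_meanders_iff)
  have "s \<in> {Up, Horizontal, Down}" for s
    by (cases s) auto
  then have "finite (UNIV :: motzkin_step set)"
    by (intro finite_subset[of UNIV "{Up, Horizontal, Down}"]) auto
  then show "finite {w. set w \<subseteq> (UNIV :: motzkin_step set) \<and> length w = n}"
    by (rule finite_lists_length_eq)
qed

lemma num_meanders_eq_card: "num_meanders L n i = card (bounded_meanders L n i)"
  by (simp add: num_meanders_def bounded_meanders_def)

lemma num_meanders_0: "num_meanders L 0 i = (if i = 0 then 1 else 0)"
proof -
  have "bounded_meanders L 0 i = (if i = 0 then {[]} else {})"
    by (auto simp: bounded_meanders_iff height_after_0)
  then show ?thesis by (simp add: num_meanders_eq_card)
qed

lemma num_meanders_outside: "L < 2 * i \<Longrightarrow> num_meanders L n i = 0"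
proof -
  assume "L < 2 * i"
  then have "bounded_meanders L n i = {}"
    by (auto simp: bounded_meanders_iff height_after_0 dest!: spec[of _ 0])
  then show ?thesis by (simp add: num_meanders_eq_card)
qed

lemma num_meanders_Suc:
  assumes "2 * i \<le> L"
  shows "num_meanders L (Suc n) i = num_meanders L n (i + 1)
    + (if 2 * i + 1 \<le> L then num_meanders L n i else 0)
    + (if i = 0 then 0 else num_meanders L n (i - 1))"
  unfolding num_meanders_eq_card bounded_meanders_Suc[OF assms]
  by (subst card_Un_disjoint card_image; auto simp: finite_bounded_meanders card_image)+

section \<open>The transfer identity\<close>

text \<open>Summation by parts: the three-term operator is symmetric up to boundary terms at H. The
  surviving one, p (H+1) * m H, equals (e - 1) * p H * m H and turns the coefficient of m H at
  height H from 1 into e.\<close>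

lemma sum_shift_exchange:
  fixes p m :: "nat \<Rightarrow> int"
  assumes "m (Suc H) = 0" and "e = 0 \<or> e = 1" and "p (Suc H) = (e - 1) * p H"
  shows "(\<Sum>i=0..H. ((if i = 0 then 0 else p (i - 1)) + p i + p (i + 1)) * m i)
    = (\<Sum>i=0..H. p i * (m (i + 1) + (if i < H then m i else e * m i)
        + (if i = 0 then 0 else m (i - 1))))"
proof -
  \<comment> \<open>No boundary condition is imposed here, so that the induction on K goes
    through.\<close>
  have gen: "(\<Sum>i=0..K. ((if i = 0 then 0 else p (i - 1)) + p i + p (i + 1)) * m i)
    = (\<Sum>i=0..K. p i * (m (i + 1) + m i + (if i = 0 then 0 else m (i - 1))))
      + p (Suc K) * m K - p K * m (Suc K)" for K
    by (induction K) (simp_all add: algebra_simps)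
  have "(\<Sum>i=0..H. p i * (m (i + 1) + (if i < H then m i else e * m i)
        + (if i = 0 then 0 else m (i - 1))))
    = (\<Sum>i=0..H. p i * (m (i + 1) + m i + (if i = 0 then 0 else m (i - 1)))
        + (if i = H then (e - 1) * p H * m H else 0))"
    by (intro sum.cong) (auto simp: algebra_simps)
  then show ?thesis
    using assms gen[of H] by (simp add: sum.distrib)
qed

text \<open>Allowing zero indices lets the induction hypothesis apply to all three neighbours, even
  those outside the triangle, where both sides vanish. The 3 is the total offset of the
  coordinates.\<close>

lemma num_forward_paths_eq_shifted:
  assumes "A + B + C = L + 3"
  shows "int (num_forward_paths L n (shifted_point A B C))
    = (\<Sum>i=0..L div 2. coeff (shifted_profile A B C) i * int (num_meanders L n i))"
  using assms
proof (induction n arbitrary: A B C)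
  case (0 A B C)
  show ?case
  proof (cases "A = 0 \<or> B = 0 \<or> C = 0")
    case True
    then show ?thesis
      using shifted_point_outside[OF True, of L]
      by (simp add: shifted_profile_eq_0 num_forward_paths_def forward_paths_outside)
  next
    case False
    then obtain a b c where abc: "A = a + 1" "B = b + 1" "C = c + 1"
      by (metis Suc_eq_plus1 not0_implies_Suc)
    with 0 have "shifted_point A B C \<in> lattice_triangle L"
      unfolding lattice_triangle_iff by force
    moreover have "(\<Sum>i=0..L div 2. coeff (shifted_profile A B C) i * int (num_meanders L 0 i))
        = (\<Sum>i=0..L div 2. if i = 0 then coeff (shifted_profile A B C) 0 else 0)"
      by (intro sum.cong) (auto simp: num_meanders_0)
    ultimately show ?thesis
      using False by (simp add: num_forward_paths_0 coeff_shifted_profile_0)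
  qed
next
  case (Suc n A B C)
  show ?case
  proof (cases "A = 0 \<or> B = 0 \<or> C = 0")
    case True
    then show ?thesis
      using shifted_point_outside[OF True, of L]
      by (simp add: shifted_profile_eq_0 num_forward_paths_def forward_paths_outside)
  next
    case False
    then obtain a b c where abc: "A = a + 1" "B = b + 1" "C = c + 1"
      by (metis Suc_eq_plus1 not0_implies_Suc)
    have L: "a + b + c = L" using Suc.prems abc by simp
    have "shifted_point (a + 1) (b + 1) (c + 1) \<in> lattice_triangle L"
      unfolding lattice_triangle_iff using L by blast
    define H where "H = L div 2"
    define p where "p = coeff (shifted_profile (a + 1) (b + 1) (c + 1))"
    define m where "m i = int (num_meanders L n i)" for i
    \<comment> \<open>Records whether a horizontal step at height H respects the amplitude bound,
      that is, whether 2H + 1 is at most L.\<close>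
    define e :: int where "e = (if even L then 0 else 1)"
    have pH: "p (Suc H) = (e - 1) * p H"
    proof (cases "even L")
      case True
      then have "Suc H + H + 2 = (a + 1) + (b + 1) + (c + 1)"
        using L by (auto simp: H_def)
      from coeff_shifted_profile_antisym[OF _ _ _ this] True show ?thesis
        by (simp add: p_def e_def)
    next
      case False
      \<comment> \<open>Here degree H + 1 is its own mirror image, so its coefficient equals its own
        negative.\<close>
      then have "Suc H + Suc H + 2 = (a + 1) + (b + 1) + (c + 1)"
        using L by (auto simp: H_def elim!: oddE)
      from coeff_shifted_profile_antisym[OF _ _ _ this] False show ?thesis
        by (simp add: p_def e_def)
    qed
    have mH: "m (Suc H) = 0"
      unfolding m_def by (simp add: num_meanders_outside H_def)
    have "int (num_forward_paths L (Suc n) (shifted_point (a + 1) (b + 1) (c + 1)))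
      = int (num_forward_paths L n (shifted_point (a + 2) (b + 1) c))
        + int (num_forward_paths L n (shifted_point a (b + 2) (c + 1)))
        + int (num_forward_paths L n (shifted_point (a + 1) b (c + 2)))"
      unfolding num_forward_paths_Suc[OF \<open>shifted_point (a + 1) (b + 1) (c + 1) \<in> _\<close>]
        sum_forward_steps shifted_point_add_step by simp
    also have "\<dots> = (\<Sum>i=0..H. (coeff (shifted_profile (a + 2) (b + 1) c) i
        + coeff (shifted_profile a (b + 2) (c + 1)) i
        + coeff (shifted_profile (a + 1) b (c + 2)) i) * m i)"
      using L by (simp add: Suc.IH distrib_right sum.distrib m_def H_def)
    also have "\<dots> = (\<Sum>i=0..H. ((if i = 0 then 0 else p (i - 1)) + p i + p (i + 1)) * m i)"
      using L coeff_shifted_profile_neighbours[of _ a b c]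
      by (intro sum.cong) (simp_all add: p_def H_def)
    also have "\<dots> = (\<Sum>i=0..H. p i * (m (i + 1) + (if i < H then m i else e * m i)
        + (if i = 0 then 0 else m (i - 1))))"
      using mH pH by (intro sum_shift_exchange) (simp_all add: e_def)
    also have "\<dots> = (\<Sum>i=0..H. p i * int (num_meanders L (Suc n) i))"
    proof (rule sum.cong[OF refl])
      fix i assume "i \<in> {0..H}"
      \<comment> \<open>Below H a horizontal step is always allowed; at H the parity of L decides,
        in agreement with \<open>e\<close>.\<close>
      then have "2 * i \<le> L" and "2 * i + 1 \<le> L \<longleftrightarrow> i < H \<or> odd L \<and> i = H"
        and "i < H \<or> i = H"
        unfolding H_def by (auto elim!: oddE evenE)
      then show "p i * (m (i + 1) + (if i < H then m i else e * m i)
          + (if i = 0 then 0 else m (i - 1))) = p i * int (num_meanders L (Suc n) i)"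
        by (auto simp: num_meanders_Suc m_def e_def)
    qed
    finally show ?thesis
      by (simp add: abc p_def H_def)
  qed
qed

theorem theorem24:
  fixes L n H :: nat and z :: "real^3"
  assumes "H = nat \<lfloor>real L / 2\<rfloor>"
    and "z \<in> lattice_triangle L"
  shows "int (num_forward_paths L n z) = (\<Sum>i=0..H. profile z i * int (num_meanders L n i))"
proof -
  from assms(2) obtain a b c where L: "a + b + c = L"
    and z: "z = shifted_point (a + 1) (b + 1) (c + 1)"
    unfolding lattice_triangle_iff by blast
  \<comment> \<open>The coordinates of z are the naturals a, b, c, which the floors return
    unchanged.\<close>
  have "profile z = coeff (shifted_profile (a + 1) (b + 1) (c + 1))"
    by (rule ext) (simp add: z profile_def profile_poly_eq_shifted shifted_point_def)
  moreover have "H = L div 2"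
    using assms(1) floor_divide_of_nat_eq[of L 2, where 'a = real] by simp
  ultimately show ?thesis
    using num_forward_paths_eq_shifted[of "a + 1" "b + 1" "c + 1" L n] L by (simp add: z)
qed

end
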